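(* For the canonical realisation described in the context, with $a=3$ or $a=4$ and any $p\in(0,1)$, the vertex condition (V) holds: there is $\varepsilon\in\{\pm1\}$ such that for every orbit $O$ and both of its sites $z\in O$, $$\varepsilon\,\mathcal W[\varphi_O,s(z;\cdot)](\gamma)>0\qquad\text{for all }\gamma\in(0,1).$$
   Context: Canonical realisation (biased random walk with geometric resetting): let $a\ge3$ be an integer, $p\in(0,1)$, $q=1-p$, with sites $z\in\{1,\dots,a-1\}$ and modes $\nu\in\{1,\dots,a-1\}$. Put $\lambda_\nu=2\sqrt{pq}\cos(\pi\nu/a)$, $f_\nu(\gamma)=(1-\gamma)/(1-\lambda_\nu(1-\gamma))$ for $\gamma\in(0,1)$, $w_\nu=\frac{2\sqrt{pq}}a\sin\frac{\pi\nu}a$, $$A_\nu(z)=w_\nu\Big(\frac qp\Big)^{z/2}\sin\frac{\pi\nu z}a,\qquad B_\nu(z)=w_\nu\Big(\frac pq\Big)^{(a-z)/2}\sin\frac{\pi\nu(a-z)}a,$$ and $s(z;\gamma)=\sum_\nu f_\nu(\gamma)(A_\nu(z)+B_\nu(z))$. The involution is $\sigma(z)=a-z$, the weights are $\kappa(z)=(p/q)^{a-z}$, $K=(p/q)^a$, $C^\ast=1/(1+\sqrt K)$. Orbits are the pairs $O=\{z,a-z\}$ with $z\ne a/2$; in each orbit a representative $z_O$ is fixed, and $\varphi_O(\gamma)=\sum_\nu f_\nu(\gamma)w^{(O)}_\nu$, where $w^{(O)}_\nu=\big[(1-C^\ast)A_\nu(z_O)-C^\ast\kappa(z_O)A_\nu(\sigma(z_O))\big]/\sqrt{\kappa(z_O)}$.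 $\mathcal W[\varphi,s]=\varphi's-\varphi s'$ (derivatives in $\gamma$). *)

theory Defs
  imports "HOL-Analysis.Analysis"
begin

text \<open>
  Biased random walk on the sites \<open>{1..a-1}\<close> with parameters \<open>p\<close>
  and \<open>q = 1 - p\<close>; \<open>\<nu>\<close> ranges over the modes \<open>{1..a-1}\<close> and \<open>\<gamma>\<close> is the resetting parameter.
\<close>

definition eigval :: "nat \<Rightarrow> real \<Rightarrow> nat \<Rightarrow> real" where
  "eigval a p \<nu> = 2 * sqrt (p * (1 - p)) * cos (pi * real \<nu> / real a)"

definition mode_fun :: "nat \<Rightarrow> real \<Rightarrow> nat \<Rightarrow> real \<Rightarrow> real" where
  "mode_fun a p \<nu> \<gamma> = (1 - \<gamma>) / (1 - eigval a p \<nu> * (1 - \<gamma>))"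

definition mode_weight :: "nat \<Rightarrow> real \<Rightarrow> nat \<Rightarrow> real" where
  "mode_weight a p \<nu> = 2 * sqrt (p * (1 - p)) / real a * sin (pi * real \<nu> / real a)"

definition coeff_A :: "nat \<Rightarrow> real \<Rightarrow> nat \<Rightarrow> nat \<Rightarrow> real" where
  "coeff_A a p \<nu> z =
     mode_weight a p \<nu> * ((1 - p) / p) powr (real z / 2) * sin (pi * real \<nu> * real z / real a)"

definition coeff_B :: "nat \<Rightarrow> real \<Rightarrow> nat \<Rightarrow> nat \<Rightarrow> real" where
  "coeff_B a p \<nu> z =
     mode_weight a p \<nu> * (p / (1 - p)) powr ((real a - real z) / 2)
       * sin (pi * real \<nu> * (real a - real z) / real a)"

definition s_fun :: "nat \<Rightarrow> real \<Rightarrow> nat \<Rightarrow> real \<Rightarrow> real" where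
  "s_fun a p z \<gamma> = (\<Sum>\<nu> = 1..a - 1. mode_fun a p \<nu> \<gamma> * (coeff_A a p \<nu> z + coeff_B a p \<nu> z))"

definition site_inv :: "nat \<Rightarrow> nat \<Rightarrow> nat" where
  "site_inv a z = a - z"

definition kappa :: "nat \<Rightarrow> real \<Rightarrow> nat \<Rightarrow> real" where
  "kappa a p z = (p / (1 - p)) ^ (a - z)"

definition K_const :: "nat \<Rightarrow> real \<Rightarrow> real" where
  "K_const a p = (p / (1 - p)) ^ a"

definition C_star :: "nat \<Rightarrow> real \<Rightarrow> real" where
  "C_star a p = 1 / (1 + sqrt (K_const a p))"

definition orbits :: "nat \<Rightarrow> nat set set" where
  "orbits a = {{z, site_inv a z} | z. z \<in> {1..a - 1} \<and> 2 * z \<noteq> a}"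

text \<open>The orbit weights and \<open>\<phi>\<close> enter only through the chosen representative \<open>z\<^sub>0\<close> of the orbit.\<close>

definition orbit_weight :: "nat \<Rightarrow> real \<Rightarrow> nat \<Rightarrow> nat \<Rightarrow> real" where
  "orbit_weight a p z\<^sub>0 \<nu> =
     ((1 - C_star a p) * coeff_A a p \<nu> z\<^sub>0
        - C_star a p * kappa a p z\<^sub>0 * coeff_A a p \<nu> (site_inv a z\<^sub>0)) / sqrt (kappa a p z\<^sub>0)"

definition orbit_fun :: "nat \<Rightarrow> real \<Rightarrow> nat \<Rightarrow> real \<Rightarrow> real" where
  "orbit_fun a p z\<^sub>0 \<gamma> = (\<Sum>\<nu> = 1..a - 1. mode_fun a p \<nu> \<gamma> * orbit_weight a p z\<^sub>0 \<nu>)"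

definition wronskian :: "(real \<Rightarrow> real) \<Rightarrow> (real \<Rightarrow> real) \<Rightarrow> real \<Rightarrow> real" where
  "wronskian f g \<gamma> = deriv f \<gamma> * g \<gamma> - f \<gamma> * deriv g \<gamma>"

text \<open>
  The function \<open>rep\<close> selects a representative of each orbit. The other choice in an orbit changes
  the sign of its \<open>\<phi>\<close>, so the sign \<open>\<epsilon>\<close> may depend on \<open>rep\<close>; it must be common to all orbits.
\<close>

definition vertex_condition :: "nat \<Rightarrow> real \<Rightarrow> (nat set \<Rightarrow> nat) \<Rightarrow> bool" where
  "vertex_condition a p rep \<longleftrightarrow>
     (\<exists>\<epsilon>\<in>{1, -1 :: real}. \<forall>orb\<in>orbits a. \<forall>z\<in>orb. \<forall>\<gamma>\<in>{0<..<1}.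
        \<epsilon> * wronskian (orbit_fun a p (rep orb)) (s_fun a p z) \<gamma> > 0)"

end

theory Submission
  imports Defs
begin

text \<open>
  With \<open>r = sqrt (p / q)\<close> and \<open>T z \<gamma> = (\<Sum>\<nu>. f\<^sub>\<nu> \<gamma> * w\<^sub>\<nu> * sin (\<pi> * \<nu> * z / a))\<close> one has
  \<open>s z = r\<^sup>-\<^sup>z * T z + r\<^sup>a\<^sup>-\<^sup>z * T (a - z)\<close> and \<open>\<phi> = (T z\<^sub>0 - T (a - z\<^sub>0)) / (1 + r\<^sup>a)\<close>. Bilinearity and
  antisymmetry of the Wronskian then give, for both sites \<open>z\<close> of the orbit of \<open>z\<^sub>0\<close>,
  \<open>W[\<phi>, s z] = r\<^sup>-\<^sup>z * W[T z\<^sub>0, T (a - z\<^sub>0)]\<close>. Since \<open>r\<close> is positive, only the sign of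
  \<open>W[T 1, T (a - 1)]\<close> matters, and for \<open>a = 3\<close> and \<open>a = 4\<close> this is explicit: writing
  \<open>u = sqrt (p * q) * (1 - \<gamma>)\<close>, the pair \<open>(T 1, T (a - 1))\<close> is proportional to \<open>(1, u)\<close> and
  \<open>(1 - u\<^sup>2, u\<^sup>2)\<close>, respectively.
\<close>

definition sine_sum :: "nat \<Rightarrow> real \<Rightarrow> nat \<Rightarrow> real \<Rightarrow> real" where
  "sine_sum a p z \<gamma> =
     (\<Sum>\<nu> = 1..a - 1. mode_fun a p \<nu> \<gamma> * (mode_weight a p \<nu> * sin (pi * real \<nu> * real z / real a)))"

section \<open>Absence of poles and differentiability\<close>

lemma sqrt_mult_compl_le_half:
  fixes p :: real
  shows "sqrt (p * (1 - p)) \<le> 1 / 2"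
proof (rule real_le_lsqrt)
  show "p * (1 - p) \<le> (1 / 2)\<^sup>2"
    using zero_le_power2[of "p - 1 / 2"] by (simp add: power2_eq_square algebra_simps)
qed simp

lemma abs_eigval_le_1:
  assumes "0 \<le> p" "p \<le> 1"
  shows "\<bar>eigval a p \<nu>\<bar> \<le> 1"
proof -
  have "0 \<le> sqrt (p * (1 - p))" using assms by simp
  then have "\<bar>2 * sqrt (p * (1 - p))\<bar> \<le> 1" using sqrt_mult_compl_le_half[of p] by linarith
  then have "\<bar>2 * sqrt (p * (1 - p))\<bar> * \<bar>cos (pi * real \<nu> / real a)\<bar> \<le> 1 * 1"
    by (intro mult_mono) auto
  then show ?thesis by (simp only: eigval_def abs_mult mult_1_left)
qed

text \<open>Keeps the mode functions free of poles, hence differentiable; its instances also give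
  the signs of the linear factors in the closed forms below.\<close>

lemma eigval_denominator_pos:
  assumes "0 \<le> p" "p \<le> 1" "0 < \<gamma>" "\<gamma> < 1"
  shows "0 < 1 - eigval a p \<nu> * (1 - \<gamma>)"
proof -
  have "eigval a p \<nu> * (1 - \<gamma>) \<le> 1 * (1 - \<gamma>)"
    using abs_eigval_le_1[OF assms(1,2), of a \<nu>] assms by (intro mult_right_mono) auto
  also have "\<dots> < 1" using assms by simp
  finally show ?thesis by (simp only: diff_gt_0_iff_gt)
qed

lemma sine_sum_differentiable:
  assumes "0 \<le> p" "p \<le> 1" "0 < \<gamma>" "\<gamma> < 1"
  shows "sine_sum a p z field_differentiable at \<gamma>"
proof -
  have "mode_fun a p \<nu> field_differentiable at \<gamma>" for \<nu>
    unfolding mode_fun_def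
    using eigval_denominator_pos[OF assms, of a \<nu>] by (intro derivative_intros) auto
  then show ?thesis unfolding sine_sum_def by (intro derivative_intros) auto
qed

section \<open>Reduction of \<open>s_fun\<close> and \<open>orbit_fun\<close> to sine sums\<close>

lemma powr_half_eq_sqrt_power:
  fixes x :: real
  assumes "0 < x"
  shows "x powr (real n / 2) = sqrt x ^ n"
  using assms by (simp add: powr_powr powr_half_sqrt[symmetric] flip: powr_realpow)

lemma sum_coeff_A:
  assumes "0 < p" "p < 1"
  shows "(\<Sum>\<nu> = 1..a - 1. mode_fun a p \<nu> \<gamma> * coeff_A a p \<nu> z)
           = sine_sum a p z \<gamma> / sqrt (p / (1 - p)) ^ z"
proof -
  have "((1 - p) / p) powr (real z / 2) = 1 / sqrt (p / (1 - p)) ^ z"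
    using assms
    by (subst powr_half_eq_sqrt_power) (auto simp: real_sqrt_divide power_divide)
  then show ?thesis
    by (simp add: coeff_A_def sine_sum_def sum_divide_distrib mult_ac)
qed

lemma sum_coeff_B:
  assumes "0 < p" "p < 1" "z \<le> a"
  shows "(\<Sum>\<nu> = 1..a - 1. mode_fun a p \<nu> \<gamma> * coeff_B a p \<nu> z)
           = sqrt (p / (1 - p)) ^ (a - z) * sine_sum a p (a - z) \<gamma>"
proof -
  have "(p / (1 - p)) powr ((real a - real z) / 2) = sqrt (p / (1 - p)) ^ (a - z)"
    using assms powr_half_eq_sqrt_power[of "p / (1 - p)" "a - z"] by (simp add: of_nat_diff)
  then show ?thesis
    using assms by (simp add: coeff_B_def sine_sum_def sum_distrib_left of_nat_diff mult_ac)
qed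

lemma s_fun_eq:
  assumes "0 < p" "p < 1" "z \<le> a"
  shows "s_fun a p z \<gamma> = sine_sum a p z \<gamma> / sqrt (p / (1 - p)) ^ z
           + sqrt (p / (1 - p)) ^ (a - z) * sine_sum a p (a - z) \<gamma>"
  using sum_coeff_A[OF assms(1,2), of a \<gamma> z] sum_coeff_B[OF assms, of \<gamma>]
  by (simp add: s_fun_def ring_distribs sum.distrib)

text \<open>Up to the factor \<open>1 / (1 + r ^ a)\<close> from \<open>C_star\<close>, the two sums
  carry the prefactors \<open>r ^ a / r ^ z\<close> and \<open>kappa a p z / r ^ (a - z)\<close>.
  Both equal \<open>r ^ (a - z)\<close>, which division by \<open>sqrt (kappa a p z)\<close>
  cancels.\<close>

lemma orbit_fun_eq:
  assumes "0 < p" "p < 1" "z \<le> a"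
  shows "orbit_fun a p z \<gamma>
           = (sine_sum a p z \<gamma> - sine_sum a p (a - z) \<gamma>) / (1 + sqrt (p / (1 - p)) ^ a)"
proof -
  define r where "r = sqrt (p / (1 - p))"
  have r: "0 < r" using assms by (simp add: r_def)
  have r2: "p / (1 - p) = r ^ 2" using assms by (simp add: r_def)
  have K: "C_star a p = 1 / (1 + r ^ a)"
    using r by (simp add: C_star_def K_const_def r_def real_sqrt_power)
  have k: "kappa a p z = r ^ (a - z) * r ^ (a - z)"
    by (simp add: kappa_def r2 power_mult_distrib power2_eq_square)
  have sk: "sqrt (kappa a p z) = r ^ (a - z)" using r by (simp add: k)
  have ra: "r ^ a = r ^ (a - z) * r ^ z" using assms by (simp flip: power_add)
  have pos: "0 < 1 + r ^ a" using r by (simp add: add_pos_pos)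
  have C: "1 - C_star a p = r ^ (a - z) * r ^ z / (1 + r ^ a)"
    using pos unfolding K ra by (simp add: field_simps)
  have "orbit_fun a p z \<gamma>
    = ((1 - C_star a p) * (\<Sum>\<nu> = 1..a - 1. mode_fun a p \<nu> \<gamma> * coeff_A a p \<nu> z)
       - C_star a p * kappa a p z * (\<Sum>\<nu> = 1..a - 1. mode_fun a p \<nu> \<gamma> * coeff_A a p \<nu> (a - z)))
      / sqrt (kappa a p z)"
    unfolding orbit_fun_def orbit_weight_def site_inv_def
    by (simp add: sum_distrib_left sum_divide_distrib diff_divide_distrib right_diff_distrib
        sum_subtractf mult_ac)
  also have "\<dots> = (r ^ (a - z) * r ^ z / (1 + r ^ a) * (sine_sum a p z \<gamma> / r ^ z)
      - 1 / (1 + r ^ a) * (r ^ (a - z) * r ^ (a - z)) * (sine_sum a p (a - z) \<gamma> / r ^ (a - z)))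
      / r ^ (a - z)"
    \<comment> \<open>\<open>C\<close> and \<open>sk\<close> come before \<open>K\<close> and
      \<open>k\<close>, which would destroy the patterns \<open>1 - C_star a p\<close> and
      \<open>sqrt (kappa a p z)\<close>.\<close>
    unfolding sum_coeff_A[OF assms(1,2)] C sk unfolding k by (simp only: r_def[symmetric] K)
  also have "\<dots> = (sine_sum a p z \<gamma> - sine_sum a p (a - z) \<gamma>) / (1 + r ^ a)"
    using r pos by (simp add: divide_simps) (simp add: algebra_simps)
  finally show ?thesis by (simp add: r_def)
qed

section \<open>Wronskian identities\<close>

lemma wronskian_swap: "wronskian g f x = - wronskian f g x"
  by (simp add: wronskian_def)

text \<open>The Wronskian is bilinear and alternating, so a linear substitution multiplies it by the
  determinant of the coefficients.\<close>

lemma wronskian_linear_combination: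
  assumes "f field_differentiable at x" "g field_differentiable at x"
  shows "wronskian (\<lambda>t. \<alpha> * f t + \<beta> * g t) (\<lambda>t. \<gamma> * f t + \<delta> * g t) x
           = (\<alpha> * \<delta> - \<beta> * \<gamma>) * wronskian f g x"
proof -
  have D: "deriv (\<lambda>t. c * f t + d * g t) x = c * deriv f x + d * deriv g x" for c d
    using assms
    by (intro DERIV_imp_deriv DERIV_add DERIV_cmult) (simp_all add: field_differentiable_derivI)
  show ?thesis unfolding wronskian_def D by (simp add: algebra_simps)
qed

text \<open>The terms in \<open>h * deriv h\<close> cancel. Agreement is asked only on an open set
  because the closed forms of the sine sums are established only for \<gamma> in the open unit
  interval.\<close>

lemma wronskian_common_factor:
  assumes "open S" "x \<in> S"
    and "\<And>t. t \<in> S \<Longrightarrow> f t = h t * F t" "\<And>t. t \<in> S \<Longrightarrow> g t = h t * G t"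
    and "h field_differentiable at x"
    and "(F has_real_derivative F') (at x)" "(G has_real_derivative G') (at x)"
  shows "wronskian f g x = (h x)\<^sup>2 * (F' * G x - F x * G')"
proof -
  have h: "(h has_real_derivative deriv h x) (at x)"
    using assms(5) by (simp add: field_differentiable_derivI)
  have "(f has_real_derivative deriv h x * F x + F' * h x) (at x)"
    using assms(1,2) assms(3)[symmetric]
    by (intro has_field_derivative_transform_within_open[OF DERIV_mult[OF h assms(6)]]) simp_all
  moreover have "(g has_real_derivative deriv h x * G x + G' * h x) (at x)"
    using assms(1,2) assms(4)[symmetric]
    by (intro has_field_derivative_transform_within_open[OF DERIV_mult[OF h assms(7)]]) simp_all
  ultimately show ?thesis
    using assms(2-4)
    by (simp add: wronskian_def DERIV_imp_deriv power2_eq_square algebra_simps)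
qed

text \<open>The coefficients of \<open>orbit_fun\<close> are opposite, so the determinant is
  symmetric in the two coefficients of \<open>s_fun\<close>. The choice of site in the orbit decides
  only which sine sum carries which coefficient, so it cannot flip the sign.\<close>

lemma wronskian_orbit_fun_s_fun:
  assumes "0 < p" "p < 1" "z0 \<le> a" "z \<in> {z0, a - z0}" "0 < \<gamma>" "\<gamma> < 1"
  shows "wronskian (orbit_fun a p z0) (s_fun a p z) \<gamma>
           = wronskian (sine_sum a p z0) (sine_sum a p (a - z0)) \<gamma> / sqrt (p / (1 - p)) ^ z"
proof -
  define r where "r = sqrt (p / (1 - p))"
  define c where "c = 1 / (1 + r ^ a)"
  let ?f = "sine_sum a p z0" and ?g = "sine_sum a p (a - z0)"
  have r: "0 < r" using assms by (simp add: r_def)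
  have pos: "0 < 1 + r ^ a" using r by (simp add: add_pos_pos)
  have z: "z \<le> a" using assms by auto
  have ra: "r ^ a = r ^ (a - z) * r ^ z" using z by (simp flip: power_add)
  \<comment> \<open>The sum in parentheses is \<open>(1 + r ^ a) / r ^ z\<close>, so
    \<open>c\<close> cancels.\<close>
  have c: "c * (r ^ (a - z) + 1 / r ^ z) = 1 / r ^ z"
    using r pos unfolding c_def by (simp add: divide_simps) (simp add: ra algebra_simps)
  have d: "?f field_differentiable at \<gamma>" "?g field_differentiable at \<gamma>"
    using assms by (auto intro: sine_sum_differentiable)
  have o: "orbit_fun a p z0 = (\<lambda>t. c * ?f t + (- c) * ?g t)"
    using assms by (auto simp: orbit_fun_eq c_def r_def diff_divide_distrib)
  consider "z = z0" | "z = a - z0" using assms by auto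
  then have "wronskian (orbit_fun a p z0) (s_fun a p z) \<gamma>
      = c * (r ^ (a - z) + 1 / r ^ z) * wronskian ?f ?g \<gamma>"
  proof cases
    case 1
    then have s: "s_fun a p z = (\<lambda>t. 1 / r ^ z * ?f t + r ^ (a - z) * ?g t)"
      using assms by (auto simp: s_fun_eq r_def)
    show ?thesis
      unfolding o s wronskian_linear_combination[OF d] by (simp add: algebra_simps)
  next
    case 2
    then have s: "s_fun a p z = (\<lambda>t. r ^ (a - z) * ?f t + 1 / r ^ z * ?g t)"
      using assms by (auto simp: s_fun_eq r_def)
    show ?thesis
      unfolding o s wronskian_linear_combination[OF d] by (simp add: algebra_simps)
  qed
  then show ?thesis unfolding c by (simp add: r_def)
qed

section \<open>Closed forms of the sine sums\<close>

text \<open>The two eigenvalues are opposite, giving denominators \<open>1 - u\<close> and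
  \<open>1 + u\<close>. Site 1 takes the sum of their reciprocals and site 2 the difference, because
  \<open>sin (pi * 4 / 3)\<close> is negative.\<close>

lemma sine_sum_3:
  assumes "0 < p" "p < 1" "0 < \<gamma>" "\<gamma> < 1"
  defines "u \<equiv> sqrt (p * (1 - p)) * (1 - \<gamma>)"
  shows "sine_sum 3 p 1 \<gamma> = u / (1 - u\<^sup>2)" "sine_sum 3 p 2 \<gamma> = u / (1 - u\<^sup>2) * u"
proof -
  define g where "g = sqrt (p * (1 - p))"
  have u: "u = g * (1 - \<gamma>)" by (simp add: u_def g_def)
  have c: "cos (pi / 3) = 1 / 2" "cos (pi * 2 / 3) = - 1 / 2"
    "sin (pi / 3) = sqrt 3 / 2" "sin (pi * 2 / 3) = sqrt 3 / 2" "sin (pi * 4 / 3) = - sqrt 3 / 2"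
    using cos_60 cos_120 sin_60 sin_120 sin_periodic_pi[of "pi / 3"]
    by (simp_all add: mult.commute)
  have D: "0 < 1 - u" "0 < 1 + u"
    using eigval_denominator_pos[of p \<gamma> 3 1] eigval_denominator_pos[of p \<gamma> 3 2] assms(1-4)
    by (simp_all add: eigval_def u_def c)
  define i j where "i = 1 / (1 - u)" and "j = 1 / (1 + u)"
  have E: "0 < 1 - u\<^sup>2"
    using mult_pos_pos[OF D] by (simp add: power2_eq_square algebra_simps)
  have ij: "i + j = 2 / (1 - u\<^sup>2)" "i - j = 2 * u / (1 - u\<^sup>2)"
    using D E unfolding i_def j_def
    by (simp_all add: divide_simps) (simp_all add: power2_eq_square algebra_simps)
  have m: "mode_fun 3 p 1 \<gamma> = (1 - \<gamma>) * i" "mode_fun 3 p 2 \<gamma> = (1 - \<gamma>) * j"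
    by (simp_all add: mode_fun_def eigval_def c u_def i_def j_def)
  have w: "mode_weight 3 p 1 = g * sqrt 3 / 3" "mode_weight 3 p 2 = g * sqrt 3 / 3"
    by (simp_all add: mode_weight_def c g_def)
  have I: "(\<Sum>\<nu> = 1..3 - 1. f \<nu>) = f 1 + f 2" for f :: "nat \<Rightarrow> real"
    by (simp add: numeral_2_eq_2)
  have S: "sine_sum 3 p z \<gamma>
      = u * (sqrt 3 / 3 * (sin (pi * real z / 3) * i + sin (pi * 2 * real z / 3) * j))" for z
    unfolding sine_sum_def I m w u by (simp add: algebra_simps)
  have "sine_sum 3 p 1 \<gamma> = u / 2 * (i + j)"
    unfolding S by (simp add: c algebra_simps)
  then show "sine_sum 3 p 1 \<gamma> = u / (1 - u\<^sup>2)" unfolding ij by simp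
  have "sine_sum 3 p 2 \<gamma> = u / 2 * (i - j)"
    unfolding S by (simp add: c algebra_simps)
  then show "sine_sum 3 p 2 \<gamma> = u / (1 - u\<^sup>2) * u" unfolding ij by simp
qed

text \<open>Modes 1 and 3, with denominators \<open>1 - sqrt 2 * u\<close> and
  \<open>1 + sqrt 2 * u\<close>, contribute equally to both sites. Mode 2 has eigenvalue 0 and adds
  \<open>u / 2\<close> at site 1 and \<open>- u / 2\<close> at site 3; it alone separates the two
  sums.\<close>

lemma sine_sum_4:
  assumes "0 < p" "p < 1" "0 < \<gamma>" "\<gamma> < 1"
  defines "u \<equiv> sqrt (p * (1 - p)) * (1 - \<gamma>)"
  shows "sine_sum 4 p 1 \<gamma> = u / (1 - 2 * u\<^sup>2) * (1 - u\<^sup>2)" "sine_sum 4 p 3 \<gamma> = u / (1 - 2 * u\<^sup>2) * u\<^sup>2"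
proof -
  define g where "g = sqrt (p * (1 - p))"
  have u: "u = g * (1 - \<gamma>)" by (simp add: u_def g_def)
  have c: "cos (pi / 4) = sqrt 2 / 2" "cos (pi * 3 / 4) = - sqrt 2 / 2"
    "sin (pi / 4) = sqrt 2 / 2" "sin (pi * 3 / 4) = sqrt 2 / 2"
    "sin (pi * 3 / 2) = - 1" "sin (pi * 9 / 4) = sqrt 2 / 2"
    using cos_45 sin_45 sin_pi_minus[of "pi / 4"] cos_pi_minus[of "pi / 4"]
      sin_3over2_pi sin_periodic[of "pi / 4"]
    by (simp_all add: mult.commute)
  have D: "0 < 1 - sqrt 2 * u" "0 < 1 + sqrt 2 * u"
    using eigval_denominator_pos[of p \<gamma> 4 1] eigval_denominator_pos[of p \<gamma> 4 3] assms(1-4)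
    by (simp_all add: eigval_def u_def c mult_ac)
  define i j where "i = 1 / (1 - sqrt 2 * u)" and "j = 1 / (1 + sqrt 2 * u)"
  have E: "0 < 1 - 2 * u\<^sup>2"
    using mult_pos_pos[OF D] by (simp add: power2_eq_square algebra_simps)
  have ij: "i + j = 2 / (1 - 2 * u\<^sup>2)"
    using D E unfolding i_def j_def
    by (simp add: divide_simps) (simp add: power2_eq_square algebra_simps)
  have m: "mode_fun 4 p 1 \<gamma> = (1 - \<gamma>) * i" "mode_fun 4 p 2 \<gamma> = 1 - \<gamma>"
    "mode_fun 4 p 3 \<gamma> = (1 - \<gamma>) * j"
    by (simp_all add: mode_fun_def eigval_def c u_def i_def j_def mult_ac)
  have w: "mode_weight 4 p 1 = g * sqrt 2 / 4" "mode_weight 4 p 2 = g / 2"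
    "mode_weight 4 p 3 = g * sqrt 2 / 4"
    by (simp_all add: mode_weight_def c g_def)
  have I: "(\<Sum>\<nu> = 1..4 - 1. f \<nu>) = f 1 + f 2 + f 3" for f :: "nat \<Rightarrow> real"
    by (simp add: numeral_2_eq_2 numeral_3_eq_3)
  have S: "sine_sum 4 p z \<gamma> = u * (sqrt 2 / 4 * (sin (pi * real z / 4) * i)
     + sin (pi * 2 * real z / 4) / 2 + sqrt 2 / 4 * (sin (pi * 3 * real z / 4) * j))" for z
    unfolding sine_sum_def I m w u by (simp add: algebra_simps)
  have "sine_sum 4 p 1 \<gamma> = u * ((i + j) / 4 + 1 / 2)"
    unfolding S by (simp add: c algebra_simps)
  then show "sine_sum 4 p 1 \<gamma> = u / (1 - 2 * u\<^sup>2) * (1 - u\<^sup>2)"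
    unfolding ij using E by (simp add: divide_simps) (simp add: algebra_simps)
  have "sine_sum 4 p 3 \<gamma> = u * ((i + j) / 4 - 1 / 2)"
    unfolding S by (simp add: c algebra_simps)
  then show "sine_sum 4 p 3 \<gamma> = u / (1 - 2 * u\<^sup>2) * u\<^sup>2"
    unfolding ij using E by (simp add: divide_simps) (simp add: algebra_simps)
qed

section \<open>Sign of the Wronskian of the sine sums\<close>

text \<open>The bound on the square keeps both denominators \<open>1 - u\<^sup>2\<close> and
  \<open>1 - 2 * u\<^sup>2\<close> positive.\<close>

lemma scaled_compl_bounds:
  fixes p \<gamma> :: real
  assumes "0 < p" "p < 1" "0 < \<gamma>" "\<gamma> < 1"
  defines "u \<equiv> sqrt (p * (1 - p)) * (1 - \<gamma>)"
  shows "0 < u" "u\<^sup>2 < 1 / 2"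
proof -
  show "0 < u" using assms by simp
  have "u \<le> 1 / 2 * 1"
    unfolding u_def using sqrt_mult_compl_le_half[of p] assms by (intro mult_mono) auto
  then have "u\<^sup>2 \<le> (1 / 2)\<^sup>2" using \<open>0 < u\<close> by (intro power_mono) auto
  then show "u\<^sup>2 < 1 / 2" by (simp add: power2_eq_square)
qed

text \<open>Without the common factor the pair is \<open>(1, u)\<close>, and \<open>u\<close> has
  slope \<open>- sqrt (p * (1 - p))\<close>, so the reduced Wronskian is
  \<open>sqrt (p * (1 - p))\<close>.\<close>

lemma wronskian_sine_sum_3_pos:
  assumes "0 < p" "p < 1" "0 < \<gamma>" "\<gamma> < 1"
  shows "0 < wronskian (sine_sum 3 p 1) (sine_sum 3 p 2) \<gamma>"
proof -
  let ?g = "sqrt (p * (1 - p))"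
  let ?u = "\<lambda>t. ?g * (1 - t)"
  let ?h = "\<lambda>t. ?u t / (1 - (?u t)\<^sup>2)"
  note b = scaled_compl_bounds[OF assms]
  have "?h field_differentiable at \<gamma>"
    using b by (intro derivative_intros) auto
  then have "wronskian (sine_sum 3 p 1) (sine_sum 3 p 2) \<gamma> = (?h \<gamma>)\<^sup>2 * (0 * ?u \<gamma> - 1 * - ?g)"
    using assms
    by (intro wronskian_common_factor[where S = "{0<..<1}"])
      (auto intro!: derivative_eq_intros simp: sine_sum_3[simplified])
  moreover have "0 < ?g" using assms by simp
  moreover have "0 < ?h \<gamma>" using b by (intro divide_pos_pos) auto
  ultimately show ?thesis
    by (simp only: mult_zero_left diff_0 mult_1_left minus_minus mult_pos_pos zero_less_power)
qed

text \<open>The reduced pair \<open>F = 1 - u\<^sup>2\<close>, \<open>G = u\<^sup>2\<close> adds up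
  to 1, so \<open>F' * G - F * G' = F'\<close>, which is positive because \<open>u\<close> is
  positive and decreasing.\<close>

lemma wronskian_sine_sum_4_pos:
  assumes "0 < p" "p < 1" "0 < \<gamma>" "\<gamma> < 1"
  shows "0 < wronskian (sine_sum 4 p 1) (sine_sum 4 p 3) \<gamma>"
proof -
  let ?g = "sqrt (p * (1 - p))"
  let ?u = "\<lambda>t. ?g * (1 - t)"
  let ?h = "\<lambda>t. ?u t / (1 - 2 * (?u t)\<^sup>2)"
  note b = scaled_compl_bounds[OF assms]
  have "?h field_differentiable at \<gamma>"
    using b by (intro derivative_intros) auto
  moreover have "((\<lambda>t. (?u t)\<^sup>2) has_real_derivative - 2 * ?g * ?u \<gamma>) (at \<gamma>)"
    "((\<lambda>t. 1 - (?u t)\<^sup>2) has_real_derivative 2 * ?g * ?u \<gamma>) (at \<gamma>)"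
    by (auto intro!: derivative_eq_intros)
  ultimately have "wronskian (sine_sum 4 p 1) (sine_sum 4 p 3) \<gamma>
      = (?h \<gamma>)\<^sup>2 * (2 * ?g * ?u \<gamma> * (?u \<gamma>)\<^sup>2 - (1 - (?u \<gamma>)\<^sup>2) * (- 2 * ?g * ?u \<gamma>))"
    using assms
    by (intro wronskian_common_factor[where S = "{0<..<1}"]) (auto simp: sine_sum_4[simplified])
  also have "\<dots> = (?h \<gamma>)\<^sup>2 * (2 * ?g * ?u \<gamma>)" by (simp add: algebra_simps)
  finally have "wronskian (sine_sum 4 p 1) (sine_sum 4 p 3) \<gamma> = (?h \<gamma>)\<^sup>2 * (2 * ?g * ?u \<gamma>)" .
  moreover have "0 < 2 * ?g * ?u \<gamma>" using assms by simp
  moreover have "0 < ?h \<gamma>" using b by (intro divide_pos_pos) auto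
  ultimately show ?thesis by (simp only: mult_pos_pos zero_less_power)
qed

text \<open>For \<open>a = 4\<close> the fixed site 2 drops out; in both cases the two sites left
  are interchanged by \<open>site_inv\<close>.\<close>

lemma orbits_3_4:
  assumes "a = 3 \<or> a = 4"
  shows "orbits a = {{1, a - 1}}"
proof -
  have sites: "z \<in> {1..a - 1} \<and> 2 * z \<noteq> a \<longleftrightarrow> z = 1 \<or> z = a - 1" for z
    using assms by auto
  have compl: "a - (a - 1) = 1" using assms by auto
  have "orbits a = {{1, a - 1}, {a - 1, a - (a - 1)}}"
    unfolding orbits_def site_inv_def sites by blast
  also have "\<dots> = {{1, a - 1}}"
    unfolding compl insert_commute[of "a - 1" 1] by simp
  finally show ?thesis .
qed

theorem proposition6p9:
  fixes a :: nat and p :: real and rep :: "nat set \<Rightarrow> nat"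
  assumes "a = 3 \<or> a = 4"
    and "0 < p" and "p < 1"
    and "\<forall>orb\<in>orbits a. rep orb \<in> orb"
  shows "vertex_condition a p rep"
proof -
  define orb where "orb = {1, a - 1}"
  \<comment> \<open>With \<open>a - 1\<close> as representative the two sine sums trade places,
    which reverses the sign of their Wronskian; as there is only one orbit, \<epsilon> can absorb
    this.\<close>
  define \<epsilon> :: real where "\<epsilon> = (if rep orb = 1 then 1 else - 1)"
  have O: "orbits a = {orb}" using orbits_3_4[OF assms(1)] by (simp add: orb_def)
  have compl: "a - (a - 1) = 1" and ne: "a - 1 \<noteq> 1" using assms(1) by auto
  have rep: "rep orb \<in> {1, a - 1}" using assms(4) by (simp add: O) (simp add: orb_def)
  have "0 < \<epsilon> * wronskian (orbit_fun a p (rep orb)) (s_fun a p z) \<gamma>"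
    if z: "z \<in> orb" and \<gamma>: "0 < \<gamma>" "\<gamma> < 1" for z \<gamma>
  proof -
    have "0 < wronskian (sine_sum a p 1) (sine_sum a p (a - 1)) \<gamma>"
      using assms(1) wronskian_sine_sum_3_pos[OF assms(2,3) \<gamma>]
        wronskian_sine_sum_4_pos[OF assms(2,3) \<gamma>] by auto
    then have "0 < \<epsilon> * wronskian (sine_sum a p (rep orb)) (sine_sum a p (a - rep orb)) \<gamma>"
      using rep compl ne wronskian_swap[of "sine_sum a p 1" "sine_sum a p (a - 1)" \<gamma>]
      by (auto simp: \<epsilon>_def)
    moreover have "0 < sqrt (p / (1 - p)) ^ z" using assms by simp
    moreover have "wronskian (orbit_fun a p (rep orb)) (s_fun a p z) \<gamma>
        = wronskian (sine_sum a p (rep orb)) (sine_sum a p (a - rep orb)) \<gamma> / sqrt (p / (1 - p)) ^ z"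
      using assms(1-3) z \<gamma> rep compl
      by (intro wronskian_orbit_fun_s_fun) (auto simp: orb_def)
    ultimately show ?thesis
      by (simp only: times_divide_eq_right divide_pos_pos)
  qed
  moreover have "\<epsilon> \<in> {1, - 1}" by (simp add: \<epsilon>_def)
  ultimately show ?thesis unfolding vertex_condition_def O by auto
qed

end
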